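(* Let $s_0$ and $s_1$ be the Bäcklund transformations (given in the context) of the system $$\frac{dx}{dt}=y,\qquad \frac{dy}{dt}=yz+\frac{2\alpha_1-1}{t^2}x+\frac{\alpha_0}{t^2},$$ $$\frac{dz}{dt}=-\frac12 z^2-\frac4t x-4y-\frac2t z+\frac{(2\alpha_1-1)(2\alpha_1-3)}{2t^2}+\frac2t .$$ The transformation $s_0s_1$ acts on the parameter $\alpha_0$ as $$s_0s_1(\alpha_0)=\alpha_0-2 .$$
   Context: The transformations are $$s_0:(x,y,z,t;\alpha_0,\alpha_1)\to\left(x,\;y,\;z+\frac{2(2\alpha_1-1)x+2\alpha_0}{t^2y},\;t;\;-\alpha_0,\;1-\alpha_1\right),$$ $$s_1:\left(x,y,z,t;\alpha_0,\tfrac32\right)\to\left(x+2G,\;y+2zG-4G^2,\;z-4G,\;t;\;-2-\alpha_0,\;\tfrac32\right),$$ with, for $\alpha_1=\tfrac32$, $G=\dfrac{2(\alpha_0+1)}{t^2(4y+z^2)+4t(2x+z-1)+4}$. In particular on the parameter $\alpha_0$ they act by $s_0(\alpha_0)=-\alpha_0$ and $s_1(\alpha_0)=-2-\alpha_0$. Transformations act as automorphisms on (polynomial) functions of the parameter $\alpha_0$, so that $s_0s_1(\alpha_0)=s_0(s_1(\alpha_0))$, where $s_0$ is applied to the expression $s_1(\alpha_0)$ by substituting $s_0(\alpha_0)$ for $\alpha_0$. *)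

theory Defs
  imports "HOL-Analysis.Analysis" "HOL-Computational_Algebra.Polynomial"
begin

definition solves_system ::
  "complex set \<Rightarrow> complex \<Rightarrow> complex \<Rightarrow>
   (complex \<Rightarrow> complex) \<Rightarrow> (complex \<Rightarrow> complex) \<Rightarrow> (complex \<Rightarrow> complex) \<Rightarrow> bool"
  where
  "solves_system U \<alpha>0 \<alpha>1 x y z \<longleftrightarrow>
     open U \<and> 0 \<notin> U \<and>
     (\<forall>t\<in>U.
        (x has_field_derivative y t) (at t) \<and>
        (y has_field_derivative
           y t * z t + (2 * \<alpha>1 - 1) / t\<^sup>2 * x t + \<alpha>0 / t\<^sup>2) (at t) \<and>
        (z has_field_derivative
           - (1 / 2) * (z t)\<^sup>2 - 4 / t * x t - 4 * y t - 2 / t * z t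
             + (2 * \<alpha>1 - 1) * (2 * \<alpha>1 - 3) / (2 * t\<^sup>2) + 2 / t) (at t))"

record point =
  px :: complex
  py :: complex
  pz :: complex
  pt :: complex
  par0 :: complex
  par1 :: complex

text \<open>
  The transformations are partial maps of points: they are undefined where a denominator vanishes,
  at the singular time \<open>t = 0\<close> of the system and, for \<open>s\<^sub>1\<close>, outside \<open>\<alpha>\<^sub>1 = 3/2\<close>.
\<close>

definition s0 :: "point \<rightharpoonup> point" where
  "s0 P =
     (if pt P \<noteq> 0 \<and> py P \<noteq> 0 then
        Some \<lparr> px = px P,
               py = py P,
               pz = pz P + (2 * (2 * par1 P - 1) * px P + 2 * par0 P) / ((pt P)\<^sup>2 * py P),
               pt = pt P,
               par0 = - par0 P,
               par1 = 1 - par1 P \<rparr>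
      else None)"

definition G_denom :: "point \<Rightarrow> complex" where
  "G_denom P =
     (pt P)\<^sup>2 * (4 * py P + (pz P)\<^sup>2) + 4 * pt P * (2 * px P + pz P - 1) + 4"

definition G_fun :: "point \<Rightarrow> complex" where
  "G_fun P = 2 * (par0 P + 1) / G_denom P"

definition s1 :: "point \<rightharpoonup> point" where
  "s1 P =
     (if par1 P = 3 / 2 \<and> pt P \<noteq> 0 \<and> G_denom P \<noteq> 0 then
        Some \<lparr> px = px P + 2 * G_fun P,
               py = py P + 2 * pz P * G_fun P - 4 * (G_fun P)\<^sup>2,
               pz = pz P - 4 * G_fun P,
               pt = pt P,
               par0 = - 2 - par0 P,
               par1 = 3 / 2 \<rparr>
      else None)"

definition backlund_transformation :: "(point \<rightharpoonup> point) \<Rightarrow> bool" where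
  "backlund_transformation s \<longleftrightarrow>
     (\<forall>U \<alpha>0 \<alpha>1 x y z.
        solves_system U \<alpha>0 \<alpha>1 x y z \<and>
        (\<forall>t\<in>U. \<lparr>px = x t, py = y t, pz = z t, pt = t, par0 = \<alpha>0, par1 = \<alpha>1\<rparr> \<in> dom s) \<longrightarrow>
        (\<exists>\<beta>0 \<beta>1 u v w.
           solves_system U \<beta>0 \<beta>1 u v w \<and>
           (\<forall>t\<in>U.
              s \<lparr>px = x t, py = y t, pz = z t, pt = t, par0 = \<alpha>0, par1 = \<alpha>1\<rparr> =
              Some \<lparr>px = u t, py = v t, pz = w t, pt = t, par0 = \<beta>0, par1 = \<beta>1\<rparr>)))"

lemma backlund_s0: "backlund_transformation s0"
  unfolding backlund_transformation_def
proof (intro allI impI, elim conjE)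
  fix U \<alpha>0 \<alpha>1 x y z
  assume sol: "solves_system U \<alpha>0 \<alpha>1 x y z"
    and d: "\<forall>t\<in>U. \<lparr>px = x t, py = y t, pz = z t, pt = t, par0 = \<alpha>0, par1 = \<alpha>1\<rparr> \<in> dom s0"
  define w where "w t = z t + (2 * (2 * \<alpha>1 - 1) * x t + 2 * \<alpha>0) / (t\<^sup>2 * y t)" for t
  have yn: "y t \<noteq> 0" "t \<noteq> 0" if "t \<in> U" for t
    using d that by (auto simp: s0_def dom_def split: if_splits)
  have "solves_system U (- \<alpha>0) (1 - \<alpha>1) x y w"
    unfolding solves_system_def
  proof (intro conjI ballI)
    show "open U" "0 \<notin> U" using sol by (auto simp: solves_system_def)
    fix t assume t: "t \<in> U"
    note nz = yn[OF t]
    have dx: "(x has_field_derivative y t) (at t)"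
      and dy: "(y has_field_derivative
           y t * z t + (2 * \<alpha>1 - 1) / t\<^sup>2 * x t + \<alpha>0 / t\<^sup>2) (at t)" (is "(y has_field_derivative ?Y) _")
      and dz: "(z has_field_derivative
           - (1 / 2) * (z t)\<^sup>2 - 4 / t * x t - 4 * y t - 2 / t * z t
             + (2 * \<alpha>1 - 1) * (2 * \<alpha>1 - 3) / (2 * t\<^sup>2) + 2 / t) (at t)" (is "(z has_field_derivative ?Z) _")
      using sol t by (auto simp: solves_system_def)
    show "(x has_field_derivative y t) (at t)" by (rule dx)
    show "(y has_field_derivative
           y t * w t + (2 * (1 - \<alpha>1) - 1) / t\<^sup>2 * x t + - \<alpha>0 / t\<^sup>2) (at t)"
      by (rule DERIV_cong[OF dy]) (use nz in \<open>simp add: w_def field_simps\<close>)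
    define q where "q t = (2 * (2 * \<alpha>1 - 1) * x t + 2 * \<alpha>0) / (t\<^sup>2 * y t)" for t
    have w_q: "w = (\<lambda>t. z t + q t)" by (simp add: w_def q_def fun_eq_iff)
    have qy: "q t * (t\<^sup>2 * y t) = 2 * (2 * \<alpha>1 - 1) * x t + 2 * \<alpha>0"
      using nz by (simp add: q_def)
    have Y: "?Y = y t * (z t + q t / 2)"
    proof -
      have e: "y t * q t = 2 * ((2 * \<alpha>1 - 1) / t\<^sup>2 * x t + \<alpha>0 / t\<^sup>2)"
        using nz by (simp add: q_def add_divide_distrib distrib_left)
      have "y t * (z t + q t / 2) = y t * z t + y t * q t / 2" by (simp add: distrib_left)
      also have "\<dots> = ?Y" unfolding e nonzero_mult_div_cancel_left[OF zero_neq_numeral[symmetric]] by (rule add.assoc[symmetric])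
      finally show ?thesis ..
    qed
    have "(q has_field_derivative
        (2 * (2 * \<alpha>1 - 1) * y t * (t\<^sup>2 * y t)
         - (2 * (2 * \<alpha>1 - 1) * x t + 2 * \<alpha>0) * (2 * t * y t + t\<^sup>2 * ?Y))
        / (t\<^sup>2 * y t * (t\<^sup>2 * y t))) (at t)"
    proof -
      have "((\<lambda>t. 2 * (2 * \<alpha>1 - 1) * x t + 2 * \<alpha>0) has_field_derivative 2 * (2 * \<alpha>1 - 1) * y t) (at t)"
        by (rule derivative_eq_intros dx refl)+ simp
      moreover have "((\<lambda>t. t\<^sup>2 * y t) has_field_derivative 2 * t * y t + t\<^sup>2 * ?Y) (at t)"
        by (rule derivative_eq_intros dy refl)+ simp
      moreover have "t\<^sup>2 * y t \<noteq> 0" using nz by simp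
      ultimately show ?thesis unfolding q_def by (rule DERIV_divide)
    qed
    then have "(q has_field_derivative
        2 * (2 * \<alpha>1 - 1) / t\<^sup>2 - q t * (2 / t + z t + q t / 2)) (at t)"
      unfolding Y qy[symmetric]
      by (rule DERIV_cong) (use nz in \<open>simp add: field_simps power2_eq_square\<close>)
    from DERIV_add[OF dz this] show "(w has_field_derivative
           - (1 / 2) * (w t)\<^sup>2 - 4 / t * x t - 4 * y t - 2 / t * w t
             + (2 * (1 - \<alpha>1) - 1) * (2 * (1 - \<alpha>1) - 3) / (2 * t\<^sup>2) + 2 / t) (at t)"
      unfolding w_q
      by (rule DERIV_cong) (use nz in \<open>simp add: field_simps power2_eq_square\<close>)
  qed
  then show "\<exists>\<beta>0 \<beta>1 u v w.
           solves_system U \<beta>0 \<beta>1 u v w \<and>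
           (\<forall>t\<in>U.
              s0 \<lparr>px = x t, py = y t, pz = z t, pt = t, par0 = \<alpha>0, par1 = \<alpha>1\<rparr> =
              Some \<lparr>px = u t, py = v t, pz = w t, pt = t, par0 = \<beta>0, par1 = \<beta>1\<rparr>)"
    using yn
    by (intro exI[of _ "- \<alpha>0"] exI[of _ "1 - \<alpha>1"] exI[of _ x] exI[of _ y] exI[of _ w])
       (auto simp: s0_def w_def)
qed

lemma backlund_s1: "backlund_transformation s1"
  unfolding backlund_transformation_def
proof (intro allI impI, elim conjE)
  fix U \<alpha>0 \<alpha>1 x y z
  assume sol: "solves_system U \<alpha>0 \<alpha>1 x y z"
    and d: "\<forall>t\<in>U. \<lparr>px = x t, py = y t, pz = z t, pt = t, par0 = \<alpha>0, par1 = \<alpha>1\<rparr> \<in> dom s1"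
  define D where "D t = t\<^sup>2 * (4 * y t + (z t)\<^sup>2) + 4 * t * (2 * x t + z t - 1) + 4" for t
  define G where "G t = 2 * (\<alpha>0 + 1) / D t" for t
  define u where "u t = x t + 2 * G t" for t
  define v where "v t = y t + 2 * z t * G t - 4 * (G t)\<^sup>2" for t
  define w where "w t = z t - 4 * G t" for t
  have nz: "\<alpha>1 = 3 / 2" "t \<noteq> 0" "D t \<noteq> 0" if "t \<in> U" for t
    using d that by (auto simp: s1_def dom_def D_def G_denom_def split: if_splits)
  have "solves_system U (- 2 - \<alpha>0) (3 / 2) u v w"
    unfolding solves_system_def
  proof (intro conjI ballI)
    show "open U" "0 \<notin> U" using sol by (auto simp: solves_system_def)
    fix t assume t: "t \<in> U"
    note tn = nz(2)[OF t] and Dn = nz(3)[OF t]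
    define Y where "Y = y t * z t + 2 / t\<^sup>2 * x t + \<alpha>0 / t\<^sup>2"
    define Z where "Z = - (1 / 2) * (z t)\<^sup>2 - 4 / t * x t - 4 * y t - 2 / t * z t + 2 / t"
    have dx: "(x has_field_derivative y t) (at t)"
      and dy: "(y has_field_derivative Y) (at t)"
      and dz: "(z has_field_derivative Z) (at t)"
      using sol t nz(1)[OF t] by (auto simp: solves_system_def Y_def Z_def)
    have "(D has_field_derivative
        2 * t * (4 * y t + (z t)\<^sup>2) + t\<^sup>2 * (4 * Y + 2 * z t * Z)
        + 4 * (2 * x t + z t - 1) + 4 * t * (2 * y t + Z)) (at t)"
      unfolding D_def
      by (rule derivative_eq_intros dx dy dz refl)+ (simp add: algebra_simps)
    then have dD: "(D has_field_derivative - z t * D t + 4 * (\<alpha>0 + 1)) (at t)"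
      by (rule DERIV_cong)
         (use tn in \<open>simp add: D_def Y_def Z_def divide_simps, simp add: algebra_simps power2_eq_square\<close>)
    have GD: "G t * D t = 2 * (\<alpha>0 + 1)" using Dn by (simp add: G_def)
    have "(G has_field_derivative
        (0 * D t - 2 * (\<alpha>0 + 1) * (- z t * D t + 4 * (\<alpha>0 + 1))) / (D t * D t)) (at t)"
      unfolding G_def by (rule DERIV_divide[OF DERIV_const dD Dn])
    then have dG: "(G has_field_derivative z t * G t - 2 * (G t)\<^sup>2) (at t)"
      by (rule DERIV_cong)
         (use Dn in \<open>simp add: G_def divide_simps, simp add: algebra_simps power2_eq_square\<close>)
    have key: "G t * (4 * y t + (z t)\<^sup>2 + 4 * (2 * x t + z t - 1) / t + 4 / t\<^sup>2)
               = 2 * (\<alpha>0 + 1) / t\<^sup>2"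
    proof -
      have "D t / t\<^sup>2 = 4 * y t + (z t)\<^sup>2 + 4 * (2 * x t + z t - 1) / t + 4 / t\<^sup>2"
        using tn by (simp add: D_def field_simps power2_eq_square)
      then show ?thesis using GD by (metis times_divide_eq_right)
    qed
    show "(u has_field_derivative v t) (at t)"
      unfolding u_def
      by (rule derivative_eq_intros dx dG refl)+ (simp add: v_def)
    have "(v has_field_derivative
        Y + 2 * (Z * G t + z t * (z t * G t - 2 * (G t)\<^sup>2))
          - 8 * G t * (z t * G t - 2 * (G t)\<^sup>2)) (at t)"
      unfolding v_def
      by (rule derivative_eq_intros dy dz dG refl)+ (simp add: algebra_simps)
    then show "(v has_field_derivative
           v t * w t + (2 * (3 / 2) - 1) / t\<^sup>2 * u t + (- 2 - \<alpha>0) / t\<^sup>2) (at t)"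
    proof (rule DERIV_cong)
      define k where "k = 1 / t"
      have k: "1 / t = k" "a / t = a * k" "a / t\<^sup>2 = a * k\<^sup>2" for a
        by (simp_all add: k_def power_divide)
      from key show "Y + 2 * (Z * G t + z t * (z t * G t - 2 * (G t)\<^sup>2))
          - 8 * G t * (z t * G t - 2 * (G t)\<^sup>2)
          = v t * w t + (2 * (3 / 2) - 1) / t\<^sup>2 * u t + (- 2 - \<alpha>0) / t\<^sup>2"
        unfolding v_def w_def u_def Y_def Z_def k by simp algebra
    qed
    have "(w has_field_derivative Z - 4 * (z t * G t - 2 * (G t)\<^sup>2)) (at t)"
      unfolding w_def
      by (rule derivative_eq_intros dz dG refl)+ simp
    then show "(w has_field_derivative
           - (1 / 2) * (w t)\<^sup>2 - 4 / t * u t - 4 * v t - 2 / t * w t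
             + (2 * (3 / 2) - 1) * (2 * (3 / 2) - 3) / (2 * t\<^sup>2) + 2 / t) (at t)"
      by (rule DERIV_cong)
         (use tn in \<open>simp add: w_def u_def v_def Z_def divide_simps, simp add: algebra_simps power2_eq_square\<close>)
  qed
  then show "\<exists>\<beta>0 \<beta>1 u v w.
           solves_system U \<beta>0 \<beta>1 u v w \<and>
           (\<forall>t\<in>U.
              s1 \<lparr>px = x t, py = y t, pz = z t, pt = t, par0 = \<alpha>0, par1 = \<alpha>1\<rparr> =
              Some \<lparr>px = u t, py = v t, pz = w t, pt = t, par0 = \<beta>0, par1 = \<beta>1\<rparr>)"
    using nz
    by (intro exI[of _ "- 2 - \<alpha>0"] exI[of _ "3 / 2"] exI[of _ u] exI[of _ v] exI[of _ w])
       (auto simp: s1_def w_def u_def v_def G_def D_def G_fun_def G_denom_def)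
qed

text \<open>
  Polynomial functions of the parameter \<open>\<alpha>\<^sub>0\<close> are represented by univariate polynomials. A
  transformation \<open>s\<close> acts on them by substitution: \<open>s(p)\<close> is the polynomial in the old parameter
  \<open>\<alpha>\<^sub>0\<close> whose value at any point of the domain of \<open>s\<close> is the value of \<open>p\<close> at the new parameter.
  Hence the composite \<open>param_action s \<circ> param_action s'\<close> substitutes \<open>s\<close> into the expression
  obtained from \<open>s'\<close>; in terms of maps of points this is \<open>s\<close> followed by \<open>s'\<close>.
\<close>

definition param_action :: "(point \<rightharpoonup> point) \<Rightarrow> complex poly \<Rightarrow> complex poly" where
  "param_action s p =
     (THE q. \<forall>P P'. s P = Some P' \<longrightarrow> poly q (par0 P) = poly p (par0 P'))"

definition alpha0 :: "complex poly" where
  "alpha0 = [:0, 1:]"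

end

theory Submission
  imports Defs
begin

text \<open>
  Each transformation changes \<open>\<alpha>\<^sub>0\<close> by a polynomial rule \<open>r\<close> (\<open>-\<alpha>\<^sub>0\<close> for \<open>s\<^sub>0\<close>, \<open>-2 - \<alpha>\<^sub>0\<close> for
  \<open>s\<^sub>1\<close>) that does not depend on the other coordinates, so its action on polynomials in \<open>\<alpha>\<^sub>0\<close>
  should be the substitution of \<open>r\<close> for \<open>\<alpha>\<^sub>0\<close>. What has to be checked is that the maps, which are
  only partial, determine this polynomial uniquely: every complex number occurs as the value of
  \<open>\<alpha>\<^sub>0\<close> at some point of the domain, and a complex polynomial is determined by its values. This is
  \<open>param_action_eq_pcompose\<close>. The action being a substitution, the composite first turns \<open>\<alpha>\<^sub>0\<close>
  into \<open>-2 - \<alpha>\<^sub>0\<close> and then replaces \<open>\<alpha>\<^sub>0\<close> by \<open>-\<alpha>\<^sub>0\<close> in this expression, which gives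
  \<open>-2 + \<alpha>\<^sub>0\<close>; the opposite order would give \<open>\<alpha>\<^sub>0 + 2\<close>.
\<close>

text \<open>
  The second hypothesis makes the description of the acted-on polynomial definite: two candidates
  agree at every complex number and hence coincide.
\<close>

lemma param_action_eq_pcompose:
  assumes rule: "\<And>P P'. s P = Some P' \<Longrightarrow> par0 P' = poly r (par0 P)"
    and onto: "\<And>a. \<exists>P\<in>dom s. par0 P = a"
  shows "param_action s p = pcompose p r"
  unfolding param_action_def
proof (rule the_equality)
  show "\<forall>P P'. s P = Some P' \<longrightarrow> poly (pcompose p r) (par0 P) = poly p (par0 P')"
    by (simp add: rule poly_pcompose)
next
  fix q
  assume q: "\<forall>P P'. s P = Some P' \<longrightarrow> poly q (par0 P) = poly p (par0 P')"
  have "poly q a = poly (pcompose p r) a" for a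
  proof -
    obtain P P' where "s P = Some P'" "par0 P = a"
      using onto[of a] by blast
    then show ?thesis
      using q rule by (metis poly_pcompose)
  qed
  then show "q = pcompose p r"
    by (simp add: poly_eq_poly_eq_iff[symmetric] fun_eq_iff)
qed

lemma param_action_s0: "param_action s0 p = pcompose p [:0, -1:]"
proof (rule param_action_eq_pcompose)
  show "par0 P' = poly [:0, -1:] (par0 P)" if "s0 P = Some P'" for P P'
    using that by (auto simp: s0_def split: if_splits)
  show "\<exists>P\<in>dom s0. par0 P = a" for a
    by (rule bexI[of _ "\<lparr>px = 0, py = 1, pz = 0, pt = 1, par0 = a, par1 = 0\<rparr>"])
       (auto simp: s0_def)
qed

lemma param_action_s1: "param_action s1 p = pcompose p [:-2, -1:]"
proof (rule param_action_eq_pcompose)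
  show "par0 P' = poly [:-2, -1:] (par0 P)" if "s1 P = Some P'" for P P'
    using that by (auto simp: s1_def split: if_splits)
  show "\<exists>P\<in>dom s1. par0 P = a" for a
    \<comment> \<open>At this point the denominator of \<open>G\<close> equals \<open>4\<close>, whatever the value of \<open>a\<close>.\<close>
    by (rule bexI[of _ "\<lparr>px = 0, py = 1, pz = 0, pt = 1, par0 = a, par1 = 3 / 2\<rparr>"])
       (auto simp: s1_def G_denom_def)
qed

theorem proposition4p2:
  shows "(param_action s0 \<circ> param_action s1) alpha0 = alpha0 - 2"
  by (simp add: param_action_s0 param_action_s1 alpha0_def pcompose_pCons numeral_poly)

end
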